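(* Let $\rho\geq1$ be a real number and consider the matrix $$A:=\begin{bmatrix}0&\rho\\0&0\end{bmatrix},$$ viewed as an operator on $\mathbb{C}^{2}$ with the standard inner product. Then $A$ is a $\rho$-contraction, and for every $0\leq s\leq 1$ there exists a rational function $g_{s}\colon\overline{D}\to\mathbb{C}$ (with poles off $\overline{D}$) with $\|g_{s}\|_{\infty}\leq1$ and $|g_{s}(0)|=s$ such that $$\|g_{s}(A)\|=k_{\rho}(s),$$ where $$k_{\rho}(s):=\frac{\rho}{2}(1-s^{2})+\sqrt{\frac{\rho^{2}}{4}(1-s^{2})^{2}+s^{2}}.$$
   Context: $D$ is the open unit disk in $\mathbb{C}$ centered at the origin, $\overline{D}$ its closure, and $\|f\|_{\infty}=\sup_{z\in\overline{D}}|f(z)|$. For a bounded operator $A$ on a Hilbert space $H$ and $\rho\geq1$, a unitary $\rho$-dilation of $A$ is a unitary operator $U$ on a Hilbert space $\mathfrak{H}$ containing $H$ as a closed subspace such that $A^{n}x=\rho\,\mathbf{P}U^{n}x$ for all $x\in H$ and $n=1,2,\ldots$, where $\mathbf{P}$ is the orthogonal projection from $\mathfrak{H}$ onto $H$. The operator $A$ is called a $\rho$-contraction if it has a unitary $\rho$-dilation. $g_s(A)$ is defined by the rational functional calculus and $\|g_s(A)\|$ is the operator norm. *)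

theory Defs
  imports
    "HOL-Analysis.Analysis"
    "HOL-Computational_Algebra.Polynomial"
    "HOL-Algebra.Module"
begin

text \<open>
  Being a \<open>\<rho>\<close>-contraction quantifies existentially over Hilbert spaces, so these are records
  with a carrier and not types. The multiplicative fields inherited from rings are
  unused.
\<close>

record 'h hilbert = "(complex, 'h) module" +
  cinner :: "'h \<Rightarrow> 'h \<Rightarrow> complex"

definition complex_ring :: "complex ring" where
  "complex_ring = \<lparr>carrier = UNIV, mult = (*), one = 1, zero = 0, add = (+)\<rparr>"

definition hnorm :: "'h hilbert \<Rightarrow> 'h \<Rightarrow> real" where
  "hnorm H x = sqrt (Re (cinner H x x))"

text \<open>The inner product is linear in its first argument.\<close>

locale hilbert_space = Module.module complex_ring H for H :: "'h hilbert" (structure) +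
  assumes cinner_add_left:
      "\<lbrakk>x \<in> carrier H; y \<in> carrier H; z \<in> carrier H\<rbrakk>
        \<Longrightarrow> cinner H (x \<oplus>\<^bsub>H\<^esub> y) z = cinner H x z + cinner H y z"
    and cinner_smult_left:
      "\<lbrakk>x \<in> carrier H; y \<in> carrier H\<rbrakk> \<Longrightarrow> cinner H (c \<odot>\<^bsub>H\<^esub> x) y = c * cinner H x y"
    and cinner_commute:
      "\<lbrakk>x \<in> carrier H; y \<in> carrier H\<rbrakk> \<Longrightarrow> cinner H x y = cnj (cinner H y x)"
    and cinner_ge_zero:
      "x \<in> carrier H \<Longrightarrow> 0 \<le> Re (cinner H x x)"
    and cinner_eq_zeroD:
      "\<lbrakk>x \<in> carrier H; cinner H x x = 0\<rbrakk> \<Longrightarrow> x = \<zero>\<^bsub>H\<^esub>"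
    and hilbert_complete:
      "\<lbrakk>\<And>n::nat. X n \<in> carrier H;
        \<And>e. e > 0 \<Longrightarrow> \<exists>N. \<forall>m\<ge>N. \<forall>n\<ge>N. hnorm H (X m \<ominus>\<^bsub>H\<^esub> X n) < e\<rbrakk>
        \<Longrightarrow> \<exists>l\<in>carrier H. (\<lambda>n. hnorm H (X n \<ominus>\<^bsub>H\<^esub> l)) \<longlonglongrightarrow> 0"

definition linear_map :: "'h hilbert \<Rightarrow> 'k hilbert \<Rightarrow> ('h \<Rightarrow> 'k) \<Rightarrow> bool" where
  "linear_map H K T \<longleftrightarrow>
     (\<forall>x\<in>carrier H. T x \<in> carrier K) \<and>
     (\<forall>x\<in>carrier H. \<forall>y\<in>carrier H. T (x \<oplus>\<^bsub>H\<^esub> y) = T x \<oplus>\<^bsub>K\<^esub> T y) \<and>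
     (\<forall>c. \<forall>x\<in>carrier H. T (c \<odot>\<^bsub>H\<^esub> x) = c \<odot>\<^bsub>K\<^esub> T x)"

definition bounded_operator :: "'h hilbert \<Rightarrow> ('h \<Rightarrow> 'h) \<Rightarrow> bool" where
  "bounded_operator H T \<longleftrightarrow>
     linear_map H H T \<and> (\<exists>M. \<forall>x\<in>carrier H. hnorm H (T x) \<le> M * hnorm H x)"

definition isometric_embedding :: "'h hilbert \<Rightarrow> 'k hilbert \<Rightarrow> ('h \<Rightarrow> 'k) \<Rightarrow> bool" where
  "isometric_embedding H K V \<longleftrightarrow>
     linear_map H K V \<and>
     (\<forall>x\<in>carrier H. \<forall>y\<in>carrier H. cinner K (V x) (V y) = cinner H x y)"

definition unitary_operator :: "'k hilbert \<Rightarrow> ('k \<Rightarrow> 'k) \<Rightarrow> bool" where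
  "unitary_operator K U \<longleftrightarrow> isometric_embedding K K U \<and> U ` carrier K = carrier K"

definition orthogonal_projection :: "'k hilbert \<Rightarrow> 'k set \<Rightarrow> ('k \<Rightarrow> 'k) \<Rightarrow> bool" where
  "orthogonal_projection K M P \<longleftrightarrow>
     (\<forall>x\<in>carrier K. P x \<in> M \<and> (\<forall>y\<in>M. cinner K (x \<ominus>\<^bsub>K\<^esub> P x) y = 0))"

text \<open>
  \<open>K\<close> contains \<open>H\<close> as a closed subspace by means of the isometric embedding \<open>V\<close>; its range
  is automatically closed because \<open>H\<close> is complete.
\<close>

definition unitary_rho_dilation ::
    "'h hilbert \<Rightarrow> real \<Rightarrow> ('h \<Rightarrow> 'h) \<Rightarrow> 'k hilbert \<Rightarrow> ('h \<Rightarrow> 'k) \<Rightarrow> ('k \<Rightarrow> 'k) \<Rightarrow> bool" where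
  "unitary_rho_dilation H \<rho> A K V U \<longleftrightarrow>
     hilbert_space K \<and> isometric_embedding H K V \<and> unitary_operator K U \<and>
     (\<exists>P. orthogonal_projection K (V ` carrier H) P \<and>
          (\<forall>n\<ge>1. \<forall>x\<in>carrier H.
             V ((A ^^ n) x) = complex_of_real \<rho> \<odot>\<^bsub>K\<^esub> P ((U ^^ n) (V x))))"

text \<open>
  The elements of the dilation space are taken from the type \<^typ>\<open>int \<Rightarrow> 'h\<close>. This is no loss of
  generality: restricting a dilation to the closed linear span of all \<open>U\<^sup>n H\<close>, \<open>n \<in> \<int>\<close>, gives
  a dilation, whose space has at most as many elements as there are functions
  \<^typ>\<open>int \<Rightarrow> 'h\<close> with values in the carrier of \<open>H\<close>, and its structure can be transported along
  an injection.
\<close>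

definition rho_contraction :: "'h hilbert \<Rightarrow> real \<Rightarrow> ('h \<Rightarrow> 'h) \<Rightarrow> bool" where
  "rho_contraction H \<rho> A \<longleftrightarrow>
     hilbert_space H \<and> bounded_operator H A \<and>
     (\<exists>(K :: (int \<Rightarrow> 'h) hilbert) V U. unitary_rho_dilation H \<rho> A K V U)"

definition cvec_space :: "(complex ^ 'n) hilbert" where
  "cvec_space = \<lparr>carrier = UNIV, mult = undefined, one = undefined, zero = 0, add = (+),
     smult = (*s), cinner = (\<lambda>x y. \<Sum>i\<in>UNIV. x $ i * cnj (y $ i))\<rparr>"

lemma hnorm_cvec_space: "hnorm cvec_space x = norm x"
  by (simp add: hnorm_def cvec_space_def norm_vec_def L2_set_def complex_mult_cnj
      cmod_power2)

lemma hilbert_space_cvec_space: "hilbert_space (cvec_space :: (complex ^ 'n) hilbert)"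
proof -
  let ?H = "cvec_space :: (complex ^ 'n) hilbert"
  have R: "cring complex_ring"
  proof (rule cringI)
    show "abelian_group complex_ring"
      by (rule abelian_groupI)
        (auto simp: complex_ring_def add.assoc add.commute intro: exI[of _ "- x" for x]
          add.right_inverse)
    show "comm_monoid complex_ring"
      by (rule comm_monoidI) (auto simp: complex_ring_def)
  qed (auto simp: complex_ring_def algebra_simps)
  have G: "abelian_group ?H"
  proof (rule abelian_groupI)
    fix x assume "x \<in> carrier ?H"
    show "\<exists>y\<in>carrier ?H. y \<oplus>\<^bsub>?H\<^esub> x = \<zero>\<^bsub>?H\<^esub>"
      by (rule bexI[of _ "- x"]) (auto simp: cvec_space_def)
  qed (auto simp: cvec_space_def algebra_simps)
  interpret Module.module complex_ring ?H
    by (rule moduleI[OF R G])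
      (auto simp: cvec_space_def complex_ring_def vec_eq_iff algebra_simps)
  have neg: "\<ominus>\<^bsub>?H\<^esub> x = - x" for x
    by (rule M.minus_equality) (auto simp: cvec_space_def)
  have minus: "x \<ominus>\<^bsub>?H\<^esub> y = x - y" for x y
    unfolding a_minus_def neg by (simp add: cvec_space_def)
  show ?thesis
  proof
    fix x y z :: "complex ^ 'n" and c :: complex
    show "cinner ?H (x \<oplus>\<^bsub>?H\<^esub> y) z = cinner ?H x z + cinner ?H y z"
      by (simp add: cvec_space_def algebra_simps sum.distrib)
    show "cinner ?H (c \<odot>\<^bsub>?H\<^esub> x) y = c * cinner ?H x y"
      by (simp add: cvec_space_def sum_distrib_left mult.assoc)
    show "cinner ?H x y = cnj (cinner ?H y x)"
      by (simp add: cvec_space_def mult.commute)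
    show "0 \<le> Re (cinner ?H x x)"
      by (simp add: cvec_space_def complex_mult_cnj sum_nonneg)
    show "x = \<zero>\<^bsub>?H\<^esub>" if "cinner ?H x x = 0"
    proof -
      have "hnorm ?H x = 0" using that by (simp add: hnorm_def)
      then show ?thesis by (simp add: hnorm_cvec_space) (simp add: cvec_space_def)
    qed
  next
    fix X :: "nat \<Rightarrow> complex ^ 'n"
    assume "\<exists>N. \<forall>m\<ge>N. \<forall>n\<ge>N. hnorm ?H (X m \<ominus>\<^bsub>?H\<^esub> X n) < e" if "e > 0" for e
    then have "Cauchy X"
      by (auto simp: Cauchy_def hnorm_cvec_space minus dist_norm)
    then obtain l where "X \<longlonglongrightarrow> l"
      using Cauchy_convergent convergent_def by blast
    then have "(\<lambda>n. hnorm ?H (X n \<ominus>\<^bsub>?H\<^esub> l)) \<longlonglongrightarrow> 0"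
      by (simp add: hnorm_cvec_space minus LIM_zero tendsto_norm_zero)
    then show "\<exists>l\<in>carrier ?H. (\<lambda>n. hnorm ?H (X n \<ominus>\<^bsub>?H\<^esub> l)) \<longlonglongrightarrow> 0"
      by (auto simp: cvec_space_def)
  qed
qed

definition disk_sup_norm :: "(complex \<Rightarrow> complex) \<Rightarrow> real" where
  "disk_sup_norm f = (SUP z\<in>cball 0 1. cmod (f z))"

definition represents_on_disk ::
    "complex poly \<Rightarrow> complex poly \<Rightarrow> (complex \<Rightarrow> complex) \<Rightarrow> bool" where
  "represents_on_disk p q g \<longleftrightarrow>
     (\<forall>z\<in>cball 0 1. poly q z \<noteq> 0 \<and> g z = poly p z / poly q z)"

text \<open>
  Powers must be formed with \<^term>\<open>(**)\<close>: the multiplication of the type class on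
  \<^typ>\<open>complex ^ 'n ^ 'n\<close> is componentwise.
\<close>

definition poly_matrix :: "complex poly \<Rightarrow> complex ^ 'n ^ 'n \<Rightarrow> complex ^ 'n ^ 'n" where
  "poly_matrix p A = (\<Sum>i\<le>degree p. map_matrix ((*) (coeff p i)) (((**) A ^^ i) (mat 1)))"

text \<open>
  \<open>(p/q)(A) = p(A) q(A)\<^sup>-\<^sup>1\<close>. When the spectrum of \<open>A\<close> lies in the closed unit disk and \<open>q\<close> has no
  zeros there, \<open>q(A)\<close> is invertible and the result depends only on the function \<open>p/q\<close>.
\<close>

definition rational_matrix ::
    "complex poly \<Rightarrow> complex poly \<Rightarrow> complex ^ 'n ^ 'n \<Rightarrow> complex ^ 'n ^ 'n" where
  "rational_matrix p q A = poly_matrix p A ** matrix_inv (poly_matrix q A)"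

definition k_rho :: "real \<Rightarrow> real \<Rightarrow> real" where
  "k_rho \<rho> s = \<rho> / 2 * (1 - s\<^sup>2) + sqrt (\<rho>\<^sup>2 / 4 * (1 - s\<^sup>2)\<^sup>2 + s\<^sup>2)"

end

theory Submission
  imports Defs
begin

text \<open>
  Write \<open>A = \<rho> N\<close>, where \<open>N\<close> maps the second basis vector to the first one and the first one
  to \<open>0\<close>. The bilateral shift \<open>U\<close> is unitary on \<open>\<ell>\<^sup>2(\<int>)\<close>, and it maps the basis vector
  \<open>e\<^sub>1\<close> to \<open>e\<^sub>0\<close>. On the span of \<open>e\<^sub>0\<close> and \<open>e\<^sub>1\<close> it therefore compresses to \<open>N\<close>, and its
  higher powers, which move both vectors out of the span, compress to \<open>0 = N\<^sup>n\<close>. Hence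
  \<open>A\<^sup>n = \<rho> P U\<^sup>n\<close> on this span: for \<open>n = 1\<close> this is \<open>A = \<rho> N\<close>, and for \<open>n \<ge> 2\<close> both sides
  vanish. By definition of \<open>rho_contraction\<close> the elements of the dilation space are functions
  from \<open>\<int>\<close> to \<open>\<complex>\<^sup>2\<close>, so the sequences in \<open>ell2\<close> are vector-valued, and \<open>e\<^sub>m\<close> is the
  sequence whose only nonzero value is the first unit vector, at index \<open>m\<close>.

  Since \<open>A\<^sup>2 = 0\<close>, the matrix \<open>g(A)\<close> depends only on the first-order Taylor polynomial of \<open>g\<close> at
  \<open>0\<close>: it has \<open>g(0)\<close> on the diagonal and \<open>\<rho> g'(0)\<close> in the corner. By the Schwarz--Pick lemma
  the corner entry can be at most \<open>\<rho> (1 - s\<^sup>2)\<close> when \<open>|g(0)| = s\<close>, and the disk automorphism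
  \<open>z \<mapsto> (z + s) / (1 + s z)\<close> attains this bound (for \<open>s = 1\<close> it degenerates to the constant
  \<open>1\<close>). The norm of the matrix with diagonal \<open>s\<close> and corner \<open>b\<close> is the positive root \<open>k\<close> of
  \<open>k\<^sup>2 = b k + s\<^sup>2\<close> (lemma \<open>onorm_upper_triangular\<close>), which for \<open>b = \<rho> (1 - s\<^sup>2)\<close> is
  \<open>k_rho \<rho> s\<close>.
\<close>

section \<open>Square-summable sequences of vectors\<close>

lemma cinner_cvec_add_left:
  "cinner cvec_space (x + y) z = cinner cvec_space x z + cinner cvec_space y z"
  by (simp add: cvec_space_def algebra_simps sum.distrib)

lemma cinner_cvec_smult_left: "cinner cvec_space (c *s x) y = c * cinner cvec_space x y"
  by (simp add: cvec_space_def sum_distrib_left mult.assoc)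

lemma cinner_cvec_commute: "cinner cvec_space x y = cnj (cinner cvec_space y x)"
  by (simp add: cvec_space_def mult.commute)

lemma cinner_cvec_0_right [simp]: "cinner cvec_space x 0 = 0"
  by (simp add: cvec_space_def)

lemma cinner_cvec_self: "cinner cvec_space x x = of_real ((norm x)\<^sup>2)"
proof -
  have "cinner cvec_space x x = (\<Sum>i\<in>UNIV. of_real ((norm (x $ i))\<^sup>2))"
    by (simp add: cvec_space_def complex_norm_square del: of_real_power)
  also have "\<dots> = of_real ((norm x)\<^sup>2)"
    by (simp add: norm_vec_def L2_set_def sum_nonneg del: of_real_power)
  finally show ?thesis .
qed

lemma norm_cinner_cvec_le:
  "norm (cinner cvec_space x y) \<le> (norm x)\<^sup>2 + (norm y)\<^sup>2"
proof -
  have "norm (cinner cvec_space x y) \<le> (\<Sum>i\<in>UNIV. norm (x $ i) * norm (y $ i))"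
    by (auto simp: cvec_space_def norm_mult intro!: order.trans[OF norm_sum])
  also have "\<dots> \<le> (\<Sum>i\<in>UNIV. (norm (x $ i))\<^sup>2 + (norm (y $ i))\<^sup>2)"
  proof (rule sum_mono)
    fix i
    show "norm (x $ i) * norm (y $ i) \<le> (norm (x $ i))\<^sup>2 + (norm (y $ i))\<^sup>2"
      using sum_squares_bound[of "norm (x $ i)" "norm (y $ i)"]
        mult_nonneg_nonneg[OF norm_ge_zero[of "x $ i"] norm_ge_zero[of "y $ i"]]
      by linarith
  qed
  also have "\<dots> = (norm x)\<^sup>2 + (norm y)\<^sup>2"
    by (simp add: norm_vec_def L2_set_def sum.distrib sum_nonneg)
  finally show ?thesis .
qed

lemma norm_cvec_smult: "norm (c *s x) = norm c * norm (x :: complex ^ 'n)"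
  by (simp add: norm_vec_def norm_mult L2_set_right_distrib)

lemma norm_add_power2_le:
  fixes x y :: "'a::real_normed_vector"
  shows "(norm (x + y))\<^sup>2 \<le> 2 * (norm x)\<^sup>2 + 2 * (norm y)\<^sup>2"
proof -
  have "(norm (x + y))\<^sup>2 \<le> (norm x + norm y)\<^sup>2"
    by (simp add: norm_triangle_ineq power_mono)
  also have "\<dots> \<le> 2 * (norm x)\<^sup>2 + 2 * (norm y)\<^sup>2"
    using sum_squares_bound[of "norm x" "norm y"] by (simp add: power2_sum)
  finally show ?thesis .
qed

definition ell2 :: "('i \<Rightarrow> complex ^ 'n) hilbert" where
  "ell2 = \<lparr>carrier = {f. (\<lambda>i. (norm (f i))\<^sup>2) summable_on UNIV},
     mult = undefined, one = undefined, zero = (\<lambda>i. 0), add = (\<lambda>f g i. f i + g i),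
     smult = (\<lambda>c f i. c *s f i),
     cinner = (\<lambda>f g. \<Sum>\<^sub>\<infinity>i. cinner cvec_space (f i) (g i))\<rparr>"

lemma ell2_simps:
  "carrier ell2 = {f. (\<lambda>i. (norm (f i))\<^sup>2) summable_on UNIV}"
  "zero ell2 = (\<lambda>i. 0)"
  "f \<oplus>\<^bsub>ell2\<^esub> g = (\<lambda>i. f i + g i)"
  "c \<odot>\<^bsub>ell2\<^esub> f = (\<lambda>i. c *s f i)"
  "cinner ell2 f g = (\<Sum>\<^sub>\<infinity>i. cinner cvec_space (f i) (g i))"
  by (simp_all add: ell2_def)

lemma ell2_add_closed:
  assumes "f \<in> carrier ell2" "g \<in> carrier ell2"
  shows "(\<lambda>i. f i + g i) \<in> carrier ell2"
proof -
  have "(\<lambda>i. 2 * (norm (f i))\<^sup>2 + 2 * (norm (g i))\<^sup>2) summable_on UNIV"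
    using assms by (intro summable_on_add summable_on_cmult_right) (simp_all add: ell2_simps)
  then show ?thesis
    unfolding ell2_simps mem_Collect_eq
    by (rule summable_on_comparison_test) (simp_all add: norm_add_power2_le)
qed

lemma ell2_smult_closed:
  "f \<in> carrier ell2 \<Longrightarrow> (\<lambda>i. c *s f i) \<in> carrier ell2"
  by (simp add: ell2_simps norm_cvec_smult power_mult_distrib summable_on_cmult_right)

lemma ell2_uminus_closed: "f \<in> carrier ell2 \<Longrightarrow> (\<lambda>i. - f i) \<in> carrier ell2"
  by (simp add: ell2_simps)

lemma ell2_diff_closed:
  "f \<in> carrier ell2 \<Longrightarrow> g \<in> carrier ell2 \<Longrightarrow> (\<lambda>i. f i - g i) \<in> carrier ell2"
  using ell2_add_closed[of f "\<lambda>i. - g i"] ell2_uminus_closed[of g] by simp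

lemma summable_cinner_ell2:
  assumes "f \<in> carrier ell2" "g \<in> carrier ell2"
  shows "(\<lambda>i. cinner cvec_space (f i) (g i)) summable_on UNIV"
proof (rule abs_summable_summable)
  have "(\<lambda>i. (norm (f i))\<^sup>2 + (norm (g i))\<^sup>2) summable_on UNIV"
    using assms by (intro summable_on_add) (simp_all add: ell2_simps)
  then show "(\<lambda>i. norm (cinner cvec_space (f i) (g i))) summable_on UNIV"
    by (rule summable_on_comparison_test) (simp_all add: norm_cinner_cvec_le)
qed

text \<open>A series that is not summable has sum \<open>0\<close> by convention, on both sides.\<close>

lemma infsum_of_real_complex:
  "(\<Sum>\<^sub>\<infinity>i\<in>S. complex_of_real (f i)) = complex_of_real (\<Sum>\<^sub>\<infinity>i\<in>S. f i)"
proof (cases "f summable_on S")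
  case True
  then show ?thesis by (intro infsumI has_sum_of_real has_sum_infsum)
next
  case False
  then have "\<not> (\<lambda>i. complex_of_real (f i)) summable_on S"
    using summable_on_bounded_linear[OF bounded_linear_Re, of "\<lambda>i. complex_of_real (f i)" S]
    by auto
  with False show ?thesis by (simp add: infsum_not_exists)
qed

lemma cinner_ell2_self: "cinner ell2 f f = of_real (\<Sum>\<^sub>\<infinity>i. (norm (f i))\<^sup>2)"
  by (simp add: ell2_simps cinner_cvec_self infsum_of_real_complex del: of_real_power)

lemma hnorm_ell2: "hnorm ell2 f = sqrt (\<Sum>\<^sub>\<infinity>i. (norm (f i))\<^sup>2)"
  by (simp add: hnorm_def cinner_ell2_self)

lemma sum_le_hnorm_ell2:
  assumes "f \<in> carrier ell2" "finite F"
  shows "(\<Sum>i\<in>F. (norm (f i))\<^sup>2) \<le> (hnorm ell2 f)\<^sup>2"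
  using assms finite_sum_le_infsum[of "\<lambda>i. (norm (f i))\<^sup>2" UNIV F]
  by (simp add: ell2_simps hnorm_ell2 infsum_nonneg)

lemma ell2_finite_sums_le:
  assumes "\<And>F. finite F \<Longrightarrow> (\<Sum>i\<in>F. (norm (f i))\<^sup>2) \<le> C\<^sup>2" and "C \<ge> 0"
  shows "f \<in> carrier ell2" and "hnorm ell2 f \<le> C"
proof -
  have *: "(\<lambda>i. (norm (f i))\<^sup>2) summable_on UNIV"
    using assms(1) by (intro nonneg_bdd_above_summable_on bdd_aboveI2[of _ _ "C\<^sup>2"]) auto
  then show "f \<in> carrier ell2" by (simp add: ell2_simps)
  have "(\<Sum>\<^sub>\<infinity>i. (norm (f i))\<^sup>2) \<le> C\<^sup>2"
    using * assms(1) by (intro infsum_le_finite_sums) auto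
  then show "hnorm ell2 f \<le> C"
    using assms(2) by (simp add: hnorm_ell2 real_le_lsqrt infsum_nonneg)
qed

lemma abelian_group_ell2: "abelian_group ell2"
proof (rule abelian_groupI)
  fix f :: "'i \<Rightarrow> complex ^ 'n" assume "f \<in> carrier ell2"
  then show "\<exists>g\<in>carrier ell2. g \<oplus>\<^bsub>ell2\<^esub> f = \<zero>\<^bsub>ell2\<^esub>"
    by (intro bexI[of _ "\<lambda>i. - f i"]) (simp_all add: ell2_uminus_closed, simp add: ell2_simps)
next
  fix f g :: "'i \<Rightarrow> complex ^ 'n" assume "f \<in> carrier ell2" "g \<in> carrier ell2"
  then show "f \<oplus>\<^bsub>ell2\<^esub> g \<in> carrier ell2"
    using ell2_add_closed[of f g] by (simp add: ell2_simps)
qed (simp_all add: ell2_simps algebra_simps)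

lemma module_ell2: "Module.module complex_ring ell2"
proof (rule moduleI)
  show "cring complex_ring"
  proof -
    interpret hilbert_space "cvec_space :: (complex ^ 1) hilbert"
      by (rule hilbert_space_cvec_space)
    show ?thesis by (rule R.is_cring)
  qed
next
  fix c and f :: "'i \<Rightarrow> complex ^ 'n" assume "f \<in> carrier ell2"
  then show "c \<odot>\<^bsub>ell2\<^esub> f \<in> carrier ell2"
    using ell2_smult_closed[of f c] by (simp add: ell2_simps)
qed (simp_all add: abelian_group_ell2 complex_ring_def,
    simp_all add: ell2_simps vec_eq_iff algebra_simps)

lemma ell2_minus:
  fixes f g :: "'i \<Rightarrow> complex ^ 'n"
  assumes "f \<in> carrier ell2" "g \<in> carrier ell2"
  shows "f \<ominus>\<^bsub>ell2\<^esub> g = (\<lambda>i. f i - g i)"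
proof -
  interpret abelian_group "ell2 :: ('i \<Rightarrow> complex ^ 'n) hilbert" by (rule abelian_group_ell2)
  have "\<ominus>\<^bsub>ell2\<^esub> g = (\<lambda>i. - g i)"
    using assms(2) ell2_uminus_closed[of g]
    by (intro minus_equality) (simp_all add: ell2_simps)
  then show ?thesis
    by (simp add: a_minus_def ell2_simps)
qed

text \<open>
  A Cauchy sequence converges pointwise, since the value at an index is bounded by the norm.
  The pointwise limit is the limit in norm, because the Cauchy estimate holds for each finite
  partial sum and thus passes to the limit.
\<close>

lemma ell2_complete:
  fixes X :: "nat \<Rightarrow> 'i \<Rightarrow> complex ^ 'n"
  assumes X: "\<And>n. X n \<in> carrier ell2"
    and Cau: "\<And>e. e > 0 \<Longrightarrow> \<exists>N. \<forall>m\<ge>N. \<forall>n\<ge>N. hnorm ell2 (X m \<ominus>\<^bsub>ell2\<^esub> X n) < e"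
  shows "\<exists>l\<in>carrier ell2. (\<lambda>n. hnorm ell2 (X n \<ominus>\<^bsub>ell2\<^esub> l)) \<longlonglongrightarrow> 0"
proof -
  note diff = ell2_diff_closed[OF X X]
  have sums: "\<exists>N. \<forall>m\<ge>N. \<forall>n\<ge>N. \<forall>F. finite F \<longrightarrow> (\<Sum>i\<in>F. (norm (X m i - X n i))\<^sup>2) \<le> e\<^sup>2"
    if e: "e > 0" for e
  proof -
    obtain N where N: "\<And>m n. m \<ge> N \<Longrightarrow> n \<ge> N \<Longrightarrow> hnorm ell2 (\<lambda>i. X m i - X n i) < e"
      using Cau[OF e] by (auto simp: ell2_minus[OF X X])
    have "(\<Sum>i\<in>F. (norm (X m i - X n i))\<^sup>2) \<le> e\<^sup>2" if "m \<ge> N" "n \<ge> N" "finite F" for m n F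
      using sum_le_hnorm_ell2[OF diff[of m n] that(3)] N[OF that(1,2)]
      by (smt (verit) hnorm_ell2 infsum_nonneg power_mono real_sqrt_ge_zero zero_le_power2)
    then show ?thesis by blast
  qed
  have "\<exists>x. (\<lambda>n. X n i) \<longlonglongrightarrow> x" for i
  proof -
    have "Cauchy (\<lambda>n. X n i)"
    proof (rule metric_CauchyI)
      fix e :: real assume "e > 0"
      then obtain N where N: "\<forall>m\<ge>N. \<forall>n\<ge>N. \<forall>F. finite F \<longrightarrow>
          (\<Sum>i\<in>F. (norm (X m i - X n i))\<^sup>2) \<le> (e/2)\<^sup>2"
        using sums[of "e/2"] by auto
      have "(norm (X m i - X n i))\<^sup>2 \<le> (e/2)\<^sup>2" if "m \<ge> N" "n \<ge> N" for m n
        using N[rule_format, OF that, of "{i}"] by simp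
      then have "norm (X m i - X n i) \<le> e/2" if "m \<ge> N" "n \<ge> N" for m n
        using that \<open>e > 0\<close> by (force intro: power2_le_imp_le[of _ "e/2"])
      then show "\<exists>N. \<forall>m\<ge>N. \<forall>n\<ge>N. dist (X m i) (X n i) < e"
        using \<open>e > 0\<close> by (intro exI[of _ N]) (force simp: dist_norm)
    qed
    then show ?thesis using Cauchy_convergent convergent_def by blast
  qed
  then obtain l where l: "\<And>i. (\<lambda>n. X n i) \<longlonglongrightarrow> l i" by metis
  have near: "\<exists>N. \<forall>n\<ge>N. (\<lambda>i. X n i - l i) \<in> carrier ell2 \<and> hnorm ell2 (\<lambda>i. X n i - l i) \<le> e"
    if e: "e > 0" for e
  proof -
    obtain N where N: "\<And>m n F. m \<ge> N \<Longrightarrow> n \<ge> N \<Longrightarrow> finite F \<Longrightarrow>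
        (\<Sum>i\<in>F. (norm (X n i - X m i))\<^sup>2) \<le> e\<^sup>2"
      using sums[OF e] by blast
    have partial: "(\<Sum>i\<in>F. (norm (X n i - l i))\<^sup>2) \<le> e\<^sup>2" if "n \<ge> N" "finite F" for n F
    proof (rule LIMSEQ_le_const2)
      show "(\<lambda>m. \<Sum>i\<in>F. (norm (X n i - X m i))\<^sup>2) \<longlonglongrightarrow> (\<Sum>i\<in>F. (norm (X n i - l i))\<^sup>2)"
        by (intro tendsto_intros l)
      show "\<exists>M. \<forall>m\<ge>M. (\<Sum>i\<in>F. (norm (X n i - X m i))\<^sup>2) \<le> e\<^sup>2"
        using N that by blast
    qed
    show ?thesis
      using ell2_finite_sums_le[OF partial] e by (intro exI[of _ N]) simp
  qed
  obtain n0 where "(\<lambda>i. X n0 i - l i) \<in> carrier ell2"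
    using near[of 1] by auto
  then have l_in: "l \<in> carrier ell2"
    using ell2_diff_closed[OF X[of n0], of "\<lambda>i. X n0 i - l i"] by simp
  have "(\<lambda>n. hnorm ell2 (\<lambda>i. X n i - l i)) \<longlonglongrightarrow> 0"
  proof (rule LIMSEQ_I)
    fix r :: real assume "r > 0"
    then obtain N where "\<forall>n\<ge>N. hnorm ell2 (\<lambda>i. X n i - l i) \<le> r/2"
      using near[of "r/2"] by auto
    then show "\<exists>N. \<forall>n\<ge>N. norm (hnorm ell2 (\<lambda>i. X n i - l i) - 0) < r"
      using \<open>r > 0\<close> by (intro exI[of _ N]) (force simp: hnorm_ell2 infsum_nonneg)
  qed
  then show ?thesis
    using l_in by (intro bexI[of _ l]) (simp_all add: ell2_minus[OF X l_in])
qed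

lemma hilbert_space_ell2: "hilbert_space (ell2 :: ('i \<Rightarrow> complex ^ 'n) hilbert)"
proof -
  interpret Module.module complex_ring "ell2 :: ('i \<Rightarrow> complex ^ 'n) hilbert"
    by (rule module_ell2)
  show ?thesis
  proof
    fix f g h :: "'i \<Rightarrow> complex ^ 'n"
    assume "f \<in> carrier ell2" "g \<in> carrier ell2" "h \<in> carrier ell2"
    then show "cinner ell2 (f \<oplus>\<^bsub>ell2\<^esub> g) h = cinner ell2 f h + cinner ell2 g h"
      by (simp add: ell2_simps(3,5) cinner_cvec_add_left infsum_add summable_cinner_ell2)
  next
    fix f g :: "'i \<Rightarrow> complex ^ 'n" and c
    show "cinner ell2 (c \<odot>\<^bsub>ell2\<^esub> f) g = c * cinner ell2 f g"
      by (simp add: ell2_simps(4,5) cinner_cvec_smult_left infsum_cmult_right')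
    show "cinner ell2 f g = cnj (cinner ell2 g f)"
      unfolding ell2_simps(5) infsum_cnj[symmetric] by (subst cinner_cvec_commute) (rule refl)
    show "0 \<le> Re (cinner ell2 f f)"
      by (simp add: cinner_ell2_self infsum_nonneg)
  next
    fix f :: "'i \<Rightarrow> complex ^ 'n"
    assume f: "f \<in> carrier ell2" and "cinner ell2 f f = 0"
    then have "(\<Sum>\<^sub>\<infinity>i. (norm (f i))\<^sup>2) \<le> 0"
      by (simp add: cinner_ell2_self)
    then have "(norm (f i))\<^sup>2 = 0" for i
      using f by (intro nonneg_infsum_le_0D[of "\<lambda>i. (norm (f i))\<^sup>2" UNIV i])
        (simp_all add: ell2_simps)
    then show "f = \<zero>\<^bsub>ell2\<^esub>" by (simp add: ell2_simps fun_eq_iff)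
  next
    fix X :: "nat \<Rightarrow> 'i \<Rightarrow> complex ^ 'n"
    assume "\<And>n. X n \<in> carrier ell2"
      "\<And>e. e > 0 \<Longrightarrow> \<exists>N. \<forall>m\<ge>N. \<forall>n\<ge>N. hnorm ell2 (X m \<ominus>\<^bsub>ell2\<^esub> X n) < e"
    then show "\<exists>l\<in>carrier ell2. (\<lambda>n. hnorm ell2 (X n \<ominus>\<^bsub>ell2\<^esub> l)) \<longlonglongrightarrow> 0"
      by (rule ell2_complete)
  qed
qed

section \<open>The shift and its compression\<close>

definition shift :: "(int \<Rightarrow> 'a) \<Rightarrow> int \<Rightarrow> 'a" where
  "shift f = (\<lambda>m. f (m + 1))"

lemma shift_power: "(shift ^^ n) f = (\<lambda>m. f (m + int n))"
  by (induction n arbitrary: f) (simp_all add: funpow_swap1 shift_def algebra_simps)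

lemma bij_add_const: "bij (\<lambda>m::int. m + k)"
  by (rule bij_betw_byWitness[of _ "\<lambda>m. m - k"]) auto

lemma translate_in_ell2:
  "(\<lambda>m::int. f (m + k)) \<in> carrier ell2 \<longleftrightarrow> f \<in> carrier ell2"
  using summable_on_reindex_bij_betw[OF bij_add_const[of k], of "\<lambda>m. (norm (f m))\<^sup>2"]
  by (simp add: ell2_simps)

lemma unitary_shift: "unitary_operator (ell2 :: (int \<Rightarrow> complex ^ 'n) hilbert) shift"
proof -
  let ?K = "ell2 :: (int \<Rightarrow> complex ^ 'n) hilbert"
  have closed: "shift f \<in> carrier ?K" if "f \<in> carrier ?K" for f
    using that by (simp add: shift_def translate_in_ell2)
  have "linear_map ?K ?K shift"
    using closed by (auto simp: linear_map_def ell2_simps(3,4)) (simp_all add: shift_def)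
  moreover have "cinner ?K (shift f) (shift g) = cinner ?K f g" for f g
    using infsum_reindex_bij_betw[OF bij_add_const[of 1], of "\<lambda>m. cinner cvec_space (f m) (g m)"]
    by (simp add: ell2_simps(5) shift_def)
  moreover have "shift ` carrier ?K = carrier ?K"
  proof
    show "carrier ?K \<subseteq> shift ` carrier ?K"
    proof
      fix f assume "f \<in> carrier ?K"
      then show "f \<in> shift ` carrier ?K"
        using translate_in_ell2[of f "-1"]
        by (intro image_eqI[of _ _ "\<lambda>m. f (m - 1)"]) (simp_all add: shift_def)
    qed
  qed (use closed in blast)
  ultimately show ?thesis
    by (simp add: unitary_operator_def isometric_embedding_def)
qed

text \<open>
  The isometry of \<open>\<complex>\<^sup>2\<close> onto the span of \<open>e\<^sub>0\<close> and \<open>e\<^sub>1\<close>, and its adjoint. Their composition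
  is the orthogonal projection onto this span.
\<close>

definition two_point :: "complex ^ 2 \<Rightarrow> int \<Rightarrow> complex ^ 2" where
  "two_point x = (\<lambda>m. if m = 0 then vector [x $ 1, 0] else if m = 1 then vector [x $ 2, 0] else 0)"

definition two_point_adj :: "(int \<Rightarrow> complex ^ 2) \<Rightarrow> complex ^ 2" where
  "two_point_adj f = vector [f 0 $ 1, f 1 $ 1]"

lemma two_point_in_ell2: "two_point x \<in> carrier ell2"
proof -
  have "(\<lambda>m. (norm (two_point x m))\<^sup>2) summable_on UNIV \<longleftrightarrow>
      (\<lambda>m. (norm (two_point x m))\<^sup>2) summable_on {0, 1}"
    by (rule summable_on_cong_neutral) (auto simp: two_point_def)
  then show ?thesis by (simp add: ell2_simps)
qed

lemma cinner_two_point: "cinner ell2 f (two_point x) = cinner cvec_space (two_point_adj f) x"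
proof -
  have "cinner ell2 f (two_point x) = (\<Sum>\<^sub>\<infinity>m\<in>{0,1}. cinner cvec_space (f m) (two_point x m))"
    unfolding ell2_simps by (rule infsum_cong_neutral) (auto simp: two_point_def)
  also have "\<dots> = cinner cvec_space (two_point_adj f) x"
    by (simp add: two_point_def two_point_adj_def cvec_space_def sum_2)
  finally show ?thesis .
qed

lemma two_point_adj_two_point [simp]: "two_point_adj (two_point x) = x"
  by (simp add: two_point_adj_def two_point_def vec_eq_iff forall_2)

lemma two_point_linear:
  "two_point (x + y) = (\<lambda>m. two_point x m + two_point y m)"
  "two_point (c *s x) = (\<lambda>m. c *s two_point x m)"
  by (auto simp: two_point_def fun_eq_iff vec_eq_iff forall_2)

lemma isometric_embedding_two_point: "isometric_embedding cvec_space ell2 two_point"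
  by (simp add: isometric_embedding_def linear_map_def two_point_in_ell2 cinner_two_point)
    (simp add: cvec_space_def ell2_simps two_point_linear)

lemma orthogonal_projection_two_point:
  "orthogonal_projection ell2 (two_point ` carrier cvec_space) (\<lambda>f. two_point (two_point_adj f))"
proof -
  have "cinner ell2 (f \<ominus>\<^bsub>ell2\<^esub> two_point (two_point_adj f)) (two_point y) = 0"
    if "f \<in> carrier ell2" for f y
    using that
    by (simp add: ell2_minus two_point_in_ell2 cinner_two_point)
      (simp add: two_point_adj_def two_point_def cvec_space_def sum_2)
  then show ?thesis
    by (auto simp: orthogonal_projection_def cvec_space_def)
qed

lemma nilpotent_mult_vec:
  "vector [vector [0, c], vector [0, 0]] *v (x :: complex ^ 2) = (vector [c * x $ 2, 0] :: complex ^ 2)"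
  by (simp add: vec_eq_iff forall_2 matrix_vector_mult_def sum_2)

lemma nilpotent_power_mult_vec:
  assumes "n \<ge> 2"
  shows "((*v) (vector [vector [0, c], vector [0, 0]]) ^^ n) (x :: complex ^ 2) = (0 :: complex ^ 2)"
proof -
  let ?N = "(*v) (vector [vector [0, c], vector [0, 0]]) :: complex ^ 2 \<Rightarrow> complex ^ 2"
  have N2: "?N (?N y) = 0" for y
    by (simp add: nilpotent_mult_vec vec_eq_iff forall_2)
  have N0: "(?N ^^ m) 0 = 0" for m
    by (induction m) simp_all
  obtain m where "n = m + 2"
    using assms le_Suc_ex by (metis add.commute)
  then have "(?N ^^ n) x = (?N ^^ m) (?N (?N x))"
    by (simp only: funpow_add numeral_2_eq_2) simp
  then show ?thesis by (simp only: N2 N0)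
qed

lemma two_point_adj_shift_power:
  assumes "n \<ge> 1"
  shows "two_point_adj ((shift ^^ n) (two_point x)) = (if n = 1 then vector [x $ 2, 0] else 0)"
  using assms
  by (auto simp: two_point_adj_def shift_power two_point_def vec_eq_iff forall_2)

lemma rho_contraction_nilpotent:
  fixes \<rho> :: real
  defines "A \<equiv> vector [vector [0, complex_of_real \<rho>], vector [0, 0]] :: complex ^ 2 ^ 2"
  shows "rho_contraction cvec_space \<rho> ((*v) A)"
proof -
  have "bounded_operator cvec_space ((*v) A)"
  proof -
    have "linear_map cvec_space cvec_space ((*v) A)"
      by (simp add: linear_map_def cvec_space_def matrix_vector_right_distrib
          vector_scalar_commute)
    moreover have "hnorm cvec_space (A *v x) \<le> \<bar>\<rho>\<bar> * hnorm cvec_space x" for x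
    proof -
      have "norm (A *v x) = \<bar>\<rho>\<bar> * norm (x $ 2)"
        by (simp add: A_def nilpotent_mult_vec norm_vec_def L2_set_def sum_2 norm_mult)
      also have "\<dots> \<le> \<bar>\<rho>\<bar> * norm x"
        by (intro mult_left_mono) (simp_all add: Finite_Cartesian_Product.norm_nth_le)
      finally show ?thesis by (simp add: hnorm_cvec_space)
    qed
    ultimately show ?thesis by (auto simp: bounded_operator_def)
  qed
  moreover have "two_point (((*v) A ^^ n) x) =
      complex_of_real \<rho> \<odot>\<^bsub>ell2\<^esub> two_point (two_point_adj ((shift ^^ n) (two_point x)))"
    if "n \<ge> 1" for n x
  proof -
    have "((*v) A ^^ n) x =
        complex_of_real \<rho> *s two_point_adj ((shift ^^ n) (two_point x))"
    proof (cases "n = 1")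
      case True
      have "A *v x = complex_of_real \<rho> *s vector [x $ 2, 0]"
        by (simp add: A_def nilpotent_mult_vec vec_eq_iff forall_2)
      with True show ?thesis unfolding two_point_adj_shift_power[OF that] by simp
    next
      case False
      with that have "n \<ge> 2" by simp
      then show ?thesis
        using that by (simp add: two_point_adj_shift_power A_def nilpotent_power_mult_vec)
    qed
    then show ?thesis by (simp add: two_point_linear ell2_simps)
  qed
  ultimately show ?thesis
    unfolding rho_contraction_def unitary_rho_dilation_def
    using hilbert_space_cvec_space hilbert_space_ell2 isometric_embedding_two_point
      unitary_shift orthogonal_projection_two_point by blast
qed

section \<open>Functional calculus and norm of the matrix\<close>

lemma mult_vec_upper_triangular:
  "vector [vector [a, b], vector [0, d]] *v (x :: complex ^ 2) =
    (vector [a * x $ 1 + b * x $ 2, d * x $ 2] :: complex ^ 2)"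
  by (simp add: vec_eq_iff forall_2 matrix_vector_mult_def sum_2)

lemma poly_matrix_nilpotent:
  "poly_matrix p (vector [vector [0, c], vector [0, 0]] :: complex ^ 2 ^ 2) =
     vector [vector [coeff p 0, c * coeff p 1], vector [0, coeff p 0]]"
proof -
  let ?N = "vector [vector [0, c], vector [0, 0]] :: complex ^ 2 ^ 2"
  define T where "T i = map_matrix ((*) (coeff p i)) (((**) ?N ^^ i) (mat 1))" for i
  have "?N ** (?N ** B) = 0" for B :: "complex ^ 2 ^ 2"
    by (simp add: vec_eq_iff forall_2 matrix_matrix_mult_def sum_2)
  then have nil: "((**) ?N ^^ (i + 2)) B = 0" for i and B :: "complex ^ 2 ^ 2"
    by (simp add: numeral_2_eq_2)
  then have high: "T i = 0" if "i \<notin> {..1}" for i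
  proof -
    have "i = (i - 2) + 2" using that by simp
    then have "((**) ?N ^^ i) (mat 1) = 0" by (metis nil)
    then show ?thesis by (simp add: T_def map_matrix_def vec_eq_iff)
  qed
  have low: "T i = 0" if "i > degree p" for i
    using that by (simp add: T_def map_matrix_def vec_eq_iff coeff_eq_0)
  have "poly_matrix p ?N = (\<Sum>i\<le>max 1 (degree p). T i)"
    unfolding poly_matrix_def T_def[symmetric] using low
    by (intro sum.mono_neutral_left) auto
  also have "\<dots> = (\<Sum>i\<le>1. T i)"
    using high by (intro sum.mono_neutral_right) auto
  also have "\<dots> = vector [vector [coeff p 0, c * coeff p 1], vector [0, coeff p 0]]"
    by (simp add: T_def map_matrix_def vec_eq_iff forall_2 mat_def matrix_matrix_mult_def sum_2)
  finally show ?thesis .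
qed

lemma matrix_inv_upper_triangular:
  fixes a b :: complex
  assumes "a \<noteq> 0"
  shows "matrix_inv (vector [vector [a, b], vector [0, a]] :: complex ^ 2 ^ 2) =
    vector [vector [1 / a, - b / a\<^sup>2], vector [0, 1 / a]]" (is "matrix_inv ?M = ?I")
proof -
  have MI: "?M ** ?I = mat 1" "?I ** ?M = mat 1"
    using assms
    by (simp_all add: vec_eq_iff forall_2 mat_def matrix_matrix_mult_def sum_2 power2_eq_square)
  then have left_inv: "matrix_inv ?M ** ?M = mat 1"
    unfolding matrix_inv_def by (metis (mono_tags, lifting) someI_ex)
  have "matrix_inv ?M = matrix_inv ?M ** (?M ** ?I)"
    by (simp only: MI(1) matrix_mul_rid)
  also have "\<dots> = ?I"
    by (simp only: matrix_mul_assoc left_inv matrix_mul_lid)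
  finally show ?thesis .
qed

text \<open>
  The fraction in the corner is the quotient rule: the entry is \<open>c\<close> times the derivative of
  \<open>p / q\<close> at \<open>0\<close>.
\<close>

lemma rational_matrix_nilpotent:
  assumes "coeff q 0 \<noteq> 0"
  shows "rational_matrix p q (vector [vector [0, c], vector [0, 0]] :: complex ^ 2 ^ 2) =
    vector [vector [coeff p 0 / coeff q 0,
        c * ((coeff p 1 * coeff q 0 - coeff p 0 * coeff q 1) / (coeff q 0)\<^sup>2)],
      vector [0, coeff p 0 / coeff q 0]]"
  using assms
  by (simp add: rational_matrix_def poly_matrix_nilpotent matrix_inv_upper_triangular
      vec_eq_iff forall_2 matrix_matrix_mult_def sum_2 field_simps power2_eq_square)

text \<open>
  For a vector with entries \<open>x\<close>, \<open>y\<close>, the relation \<open>k\<^sup>2 = b k + s\<^sup>2\<close> turns \<open>k\<close> times the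
  difference of \<open>k\<^sup>2 (|x|\<^sup>2 + |y|\<^sup>2)\<close> and the squared norm of the image into \<open>b |k x - s y|\<^sup>2\<close>.
  So \<open>k\<close> bounds the norm, with equality for \<open>x = s\<close>, \<open>y = k\<close>, whose image is
  \<open>k\<close> times the vector with entries \<open>k\<close>, \<open>s\<close>.
\<close>

lemma onorm_upper_triangular:
  fixes s b k :: real
  assumes "b \<ge> 0" "k > 0" and k: "k\<^sup>2 = b * k + s\<^sup>2"
  defines "M \<equiv> vector [vector [complex_of_real s, complex_of_real b],
    vector [0, complex_of_real s]] :: complex ^ 2 ^ 2"
  shows "onorm ((*v) M) = k"
proof (rule antisym)
  have norm2: "(norm (x :: complex ^ 2))\<^sup>2 = (norm (x $ 1))\<^sup>2 + (norm (x $ 2))\<^sup>2" for x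
    by (simp add: norm_vec_def L2_set_def sum_2)
  show "onorm ((*v) M) \<le> k"
  proof (rule onorm_le)
    fix v :: "complex ^ 2"
    have ident: "k * (k\<^sup>2 * (x\<^sup>2 + y\<^sup>2) - ((s * x + b * y)\<^sup>2 + (s * y)\<^sup>2)) = b * (k * x - s * y)\<^sup>2"
      for x y :: real
    proof -
      have "k * (k\<^sup>2 * (x\<^sup>2 + y\<^sup>2) - ((s * x + b * y)\<^sup>2 + (s * y)\<^sup>2)) - b * (k * x - s * y)\<^sup>2 =
          (k\<^sup>2 - b * k - s\<^sup>2) * (k * x\<^sup>2 + (k + b) * y\<^sup>2)"
        by (simp add: power2_eq_square algebra_simps)
      then show ?thesis using k by simp
    qed
    have "k * (k\<^sup>2 * (norm v)\<^sup>2 - (norm (M *v v))\<^sup>2) =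
        b * (k * Re (v $ 1) - s * Re (v $ 2))\<^sup>2 + b * (k * Im (v $ 1) - s * Im (v $ 2))\<^sup>2"
      unfolding ident[symmetric]
      by (simp add: norm2 M_def mult_vec_upper_triangular cmod_power2 algebra_simps)
    then have "0 \<le> k * (k\<^sup>2 * (norm v)\<^sup>2 - (norm (M *v v))\<^sup>2)"
      using assms(1) by simp
    then have "0 \<le> k\<^sup>2 * (norm v)\<^sup>2 - (norm (M *v v))\<^sup>2"
      using assms(2) by (metis mult_le_cancel_left_pos mult_zero_right)
    then have "(norm (M *v v))\<^sup>2 \<le> (k * norm v)\<^sup>2"
      by (simp only: power_mult_distrib diff_ge_0_iff_ge)
    moreover have "0 \<le> k * norm v"
      using assms(2) by simp
    ultimately show "norm (M *v v) \<le> k * norm v"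
      by (rule power2_le_imp_le)
  qed
  let ?v = "vector [complex_of_real s, complex_of_real k] :: complex ^ 2"
  have "M *v ?v = vector [complex_of_real (k * k), complex_of_real (k * s)]"
    using k by (simp add: M_def mult_vec_upper_triangular vec_eq_iff forall_2 power2_eq_square
        flip: of_real_mult of_real_add)
  then have "(norm (M *v ?v))\<^sup>2 = (k * norm ?v)\<^sup>2"
    by (simp add: norm2 norm_mult algebra_simps)
  then have "norm (M *v ?v) = k * norm ?v"
    using assms(2) by simp
  moreover have "bounded_linear ((*v) M)"
    unfolding linear_conv_bounded_linear[symmetric]
  proof (rule linearI)
    show "M *v (x + y) = M *v x + M *v y" for x y
      by (rule matrix_vector_right_distrib)
    show "M *v (r *\<^sub>R x) = r *\<^sub>R (M *v x)" for r x
      by (simp add: matrix_vector_mult_def vec_eq_iff scaleR_sum_right)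
  qed
  ultimately have "k * norm ?v \<le> onorm ((*v) M) * norm ?v"
    using onorm by metis
  moreover have "norm ?v > 0"
    using assms(2) by (simp add: vec_eq_iff forall_2)
  ultimately show "k \<le> onorm ((*v) M)" by simp
qed

lemma k_rho_root:
  assumes "\<rho> > 0" "0 \<le> s" "s \<le> 1"
  shows "k_rho \<rho> s > 0" and "(k_rho \<rho> s)\<^sup>2 = \<rho> * (1 - s\<^sup>2) * k_rho \<rho> s + s\<^sup>2"
proof -
  define b where "b = \<rho> * (1 - s\<^sup>2)"
  define r where "r = sqrt (b\<^sup>2 / 4 + s\<^sup>2)"
  have b: "b \<ge> 0" using assms by (simp add: b_def power_le_one)
  have kr: "k_rho \<rho> s = b / 2 + r"
    by (simp add: k_rho_def b_def r_def power_mult_distrib)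
  have "b > 0 \<or> s > 0"
    using assms by (cases "s = 0") (auto simp: b_def)
  then have "b\<^sup>2 / 4 + s\<^sup>2 > 0"
    by (auto intro: add_pos_nonneg add_nonneg_pos)
  then have "r > 0" by (simp add: r_def)
  with b show "k_rho \<rho> s > 0" by (simp add: kr)
  have "r\<^sup>2 = b\<^sup>2 / 4 + s\<^sup>2" by (simp add: r_def)
  then show "(k_rho \<rho> s)\<^sup>2 = \<rho> * (1 - s\<^sup>2) * k_rho \<rho> s + s\<^sup>2"
    unfolding kr b_def[symmetric] by (simp add: power2_eq_square algebra_simps)
qed

text \<open>
  Both parts come from \<open>|s z| \<le> s < 1\<close> and the identity
  \<open>|1 + s z|\<^sup>2 - |s + z|\<^sup>2 = (1 - s\<^sup>2) (1 - |z|\<^sup>2)\<close>.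
\<close>

lemma disk_automorphism_bound:
  fixes s :: real and z :: complex
  assumes "0 \<le> s" "s < 1" "norm z \<le> 1"
  shows "1 + s * z \<noteq> 0" and "norm ((s + z) / (1 + s * z)) \<le> 1"
proof -
  have "norm (s * z) \<le> s"
    using assms by (simp add: norm_mult mult_left_le)
  then show nz: "1 + s * z \<noteq> 0"
    using assms(2) by (metis add_eq_0_iff norm_minus_cancel norm_one not_le)
  have "(norm (1 + s * z))\<^sup>2 - (norm (s + z))\<^sup>2 = (1 - s\<^sup>2) * (1 - (norm z)\<^sup>2)"
    by (simp add: cmod_power2) (simp add: power2_eq_square algebra_simps)
  also have "\<dots> \<ge> 0"
    using assms by (simp add: power_le_one)
  finally have "(norm (s + z))\<^sup>2 \<le> (norm (1 + s * z))\<^sup>2" by (simp only: diff_ge_0_iff_ge)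
  then have "norm (s + z) \<le> norm (1 + s * z)"
    by (rule power2_le_imp_le) (rule norm_ge_zero)
  then show "norm ((s + z) / (1 + s * z)) \<le> 1"
    using nz by (simp only: norm_divide divide_le_eq_1 zero_less_norm_iff) simp
qed

text \<open>
  At \<open>s = 1\<close> the numerator and the denominator of the automorphism share the zero \<open>-1\<close>, which
  lies on the circle, so they are replaced by constants.
\<close>

lemma schwarz_pick_extremal:
  assumes "0 \<le> s" "s \<le> 1"
  obtains p q :: "complex poly" where
    "\<And>z. norm z \<le> 1 \<Longrightarrow> poly q z \<noteq> 0 \<and> norm (poly p z / poly q z) \<le> 1"
    "coeff p 0 = of_real s" "coeff q 0 = 1"
    "coeff p 1 - coeff p 0 * coeff q 1 = of_real (1 - s\<^sup>2)"
proof (cases "s = 1")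
  case True
  show ?thesis
    by (rule that[of 1 1]) (use True in simp_all)
next
  case False
  with assms have "s < 1" by simp
  with assms show ?thesis
    using disk_automorphism_bound[of s]
    by (intro that[of "[:1, of_real s:]" "[:of_real s, 1:]"])
      (auto simp: power2_eq_square mult.commute)
qed

theorem mainTheorem2:
  fixes \<rho> :: real and A :: "complex ^ 2 ^ 2"
  assumes "\<rho> \<ge> 1"
    and "A = vector [vector [0, complex_of_real \<rho>], vector [0, 0]]"
  shows "rho_contraction cvec_space \<rho> ((*v) A) \<and>
    (\<forall>s::real. 0 \<le> s \<and> s \<le> 1 \<longrightarrow>
      (\<exists>(g :: complex \<Rightarrow> complex) p q.
         represents_on_disk p q g \<and>
         disk_sup_norm g \<le> 1 \<and>
         cmod (g 0) = s \<and>
         onorm ((*v) (rational_matrix p q A)) = k_rho \<rho> s))"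
proof (intro conjI allI impI)
  show "rho_contraction cvec_space \<rho> ((*v) A)"
    unfolding assms(2) by (rule rho_contraction_nilpotent)
next
  fix s :: real assume "0 \<le> s \<and> s \<le> 1"
  then have s: "0 \<le> s" "s \<le> 1" by auto
  obtain p q :: "complex poly" where
    bound: "\<And>z. norm z \<le> 1 \<Longrightarrow> poly q z \<noteq> 0 \<and> norm (poly p z / poly q z) \<le> 1"
    and coeffs: "coeff p 0 = of_real s" "coeff q 0 = 1"
      "coeff p 1 - coeff p 0 * coeff q 1 = of_real (1 - s\<^sup>2)"
    using schwarz_pick_extremal[OF s] by metis
  let ?g = "\<lambda>z. poly p z / poly q z"
  have "represents_on_disk p q ?g"
    using bound by (simp add: represents_on_disk_def)
  moreover have "disk_sup_norm ?g \<le> 1"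
    unfolding disk_sup_norm_def using bound by (intro cSUP_least) auto
  moreover have "cmod (?g 0) = s"
    using coeffs s by (simp add: poly_0_coeff_0)
  moreover have "onorm ((*v) (rational_matrix p q A)) = k_rho \<rho> s"
  proof -
    have "rational_matrix p q A = vector [vector [of_real s, of_real (\<rho> * (1 - s\<^sup>2))],
        vector [0, of_real s]]"
      unfolding assms(2) using coeffs by (simp add: rational_matrix_nilpotent)
    then show ?thesis
      using onorm_upper_triangular[of "\<rho> * (1 - s\<^sup>2)" "k_rho \<rho> s" s] k_rho_root[of \<rho> s] assms(1) s
      by (simp add: power_le_one)
  qed
  ultimately show "\<exists>g p q. represents_on_disk p q g \<and> disk_sup_norm g \<le> 1 \<and>
      cmod (g 0) = s \<and> onorm ((*v) (rational_matrix p q A)) = k_rho \<rho> s"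
    by blast
qed

end
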